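(* Let $m\ge2$. The following regret bounds hold. (i) Let $C=(c_{jk})$ be an $m\times m$ cost matrix. For all $\eta\in\Delta_m$ and $\tau\in\mathbb R^{m-1}$, $$\frac1m\Big\{\sum_{j=1}^m\eta_jL^{\mathrm{cw}}(j,\tau^\dagger)-H^{\mathrm{cw}}(\eta)\Big\}\le\sum_{j=1}^m\eta_jL^{\mathrm{cw3}}(j,\tau)-H_{L^{\mathrm{cw3}}}(\eta),$$ where $\tau^\dagger=(\tau_1,\ldots,\tau_{m-1},1-\sum_{k=1}^{m-1}\tau_{k+})^{T}$. (ii) For all $\eta\in\Delta_m$ and $\tau\in\mathbb R^{m-1}$, $$\frac1m\Big\{\sum_{j=1}^m\eta_jL^{\mathrm{zo}}(j,\tilde\tau)-H^{\mathrm{zo}}(\eta)\Big\}\le\sum_{j=1}^m\eta_jL^{\mathrm{zo4}}(j,\tau)-H_{L^{\mathrm{zo4}}}(\eta),$$ where $\tilde\tau=(\tau_1,\ldots,\tau_{m-1},1-\sum_{k=1}^{m-1}\tau_k)^{T}$.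
   Context: $\Delta_m=\{q\in\mathbb R^m: q_j\ge0,\ \sum_jq_j=1\}$; $b_+=\max(0,b)$ and $\tau_{k+}=(\tau_k)_+$. For a loss $L(j,\gamma)$ with action space $\mathcal A$, $H_L(\eta)=\inf_{\gamma\in\mathcal A}\sum_j\eta_jL(j,\gamma)$. A cost matrix is $C=(c_{jk})=(C_1,\ldots,C_m)$ (columns $C_k$) with $c_{jk}\ge0$, $c_{jj}=0$, and for each $j$, $c_{jk}>0$ for some $k\ne j$. Classification losses, for $\gamma\in\mathbb R^m$ (argmax is a single index of a maximum component, ties broken by any fixed rule): $L^{\mathrm{cw}}(j,\gamma)=c_{jk}$ if $k=\mathrm{argmax}_l\gamma_l$, with $H^{\mathrm{cw}}(\eta)=\min_k\eta^{T}C_k$; $L^{\mathrm{zo}}(j,\gamma)=1\{j\ne\mathrm{argmax}_k\gamma_k\}$, with $H^{\mathrm{zo}}(\eta)=1-\max_k\eta_k$. Hinge-like losses, for $\tau\in\mathbb R^{m-1}$: $L^{\mathrm{cw3}}(j,\tau)=c_{jm}(\tau^{(j)}_m)_++\sum_{k\in\{1,\ldots,m-1\},k\ne j}c_{jk}\tau_{k+}$ for $j\le m-1$, with $\tau^{(j)}_m=1-\tau_j-\sum_{k\in\{1,\ldots,m-1\},k\ne j}\tau_{k+}$, and $L^{\mathrm{cw3}}(m,\tau)=\sum_{k=1}^{m-1}c_{mk}\tau_{k+}$. $L^{\mathrm{zo4}}(j,\tau)=1-\tilde\tau_j+S^{(j)}_\tau$ for $j\in\{1,\dots,m\}$, with $\tilde\tau$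 as in (ii) and $$S^{(j)}_\tau=\max\Big\{0,\tilde\tau_j-1,\tfrac{\tilde\tau_j+\tilde\tau_{j(1)}-1}{2},\ldots,\tfrac{\tilde\tau_j+\tilde\tau_{j(1)}+\cdots+\tilde\tau_{j(m-2)}-1}{m-1}\Big\},$$ where $\tilde\tau_{j(1)}\ge\cdots\ge\tilde\tau_{j(m-1)}$ are the sorted components of $\tilde\tau$ excluding $\tilde\tau_j$. *)

theory Defs
  imports "HOL-Analysis.Analysis" "HOL-Library.FuncSet"
begin

text \<open>
  Vectors in \<open>\<real>\<^sup>n\<close> are functions on \<open>{1..n}\<close> that are \<^const>\<open>undefined\<close> elsewhere, so that
  \<open>\<real>\<^sup>m\<close> and \<open>\<real>\<^sup>m\<^sup>-\<^sup>1\<close> can occur side by side with \<open>m\<close> a term variable.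
\<close>

definition Rvec :: "nat \<Rightarrow> (nat \<Rightarrow> real) set" where
  "Rvec n = {1..n} \<rightarrow>\<^sub>E UNIV"

definition prob_simplex :: "nat \<Rightarrow> (nat \<Rightarrow> real) set" where
  "prob_simplex m = {q \<in> Rvec m. (\<forall>j\<in>{1..m}. 0 \<le> q j) \<and> (\<Sum>j=1..m. q j) = 1}"

abbreviation pos :: "real \<Rightarrow> real" where
  "pos b \<equiv> max 0 b"

definition risk :: "nat \<Rightarrow> (nat \<Rightarrow> 'a \<Rightarrow> real) \<Rightarrow> (nat \<Rightarrow> real) \<Rightarrow> 'a \<Rightarrow> real" where
  "risk m L \<eta> \<gamma> = (\<Sum>j=1..m. \<eta> j * L j \<gamma>)"

text \<open>
  The generalized entropy \<open>H\<^sub>L\<close>. All losses below are nonnegative on \<open>{1..m}\<close>, so the infimum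
  is over a nonempty set bounded below (see \<open>bdd_below_risk\<close>).
\<close>

definition entropy :: "nat \<Rightarrow> 'a set \<Rightarrow> (nat \<Rightarrow> 'a \<Rightarrow> real) \<Rightarrow> (nat \<Rightarrow> real) \<Rightarrow> real" where
  "entropy m A L \<eta> = (INF \<gamma>\<in>A. risk m L \<eta> \<gamma>)"

definition cost_matrix :: "nat \<Rightarrow> (nat \<Rightarrow> nat \<Rightarrow> real) \<Rightarrow> bool" where
  "cost_matrix m C \<longleftrightarrow>
     (\<forall>j\<in>{1..m}. (\<forall>k\<in>{1..m}. 0 \<le> C j k) \<and> C j j = 0 \<and> (\<exists>k\<in>{1..m}. k \<noteq> j \<and> 0 < C j k))"

text \<open>
  A single-valued argmax with a fixed but arbitrary way of breaking ties.
\<close>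

definition argmax_rule :: "nat \<Rightarrow> ((nat \<Rightarrow> real) \<Rightarrow> nat) \<Rightarrow> bool" where
  "argmax_rule m am \<longleftrightarrow>
     (\<forall>\<gamma>\<in>Rvec m. am \<gamma> \<in> {1..m} \<and> (\<forall>l\<in>{1..m}. \<gamma> l \<le> \<gamma> (am \<gamma>)))"

definition L_cw :: "((nat \<Rightarrow> real) \<Rightarrow> nat) \<Rightarrow> (nat \<Rightarrow> nat \<Rightarrow> real) \<Rightarrow> nat \<Rightarrow> (nat \<Rightarrow> real) \<Rightarrow> real" where
  "L_cw am C j \<gamma> = C j (am \<gamma>)"

definition H_cw :: "nat \<Rightarrow> (nat \<Rightarrow> nat \<Rightarrow> real) \<Rightarrow> (nat \<Rightarrow> real) \<Rightarrow> real" where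
  "H_cw m C \<eta> = (MIN k\<in>{1..m}. \<Sum>j=1..m. \<eta> j * C j k)"

definition L_zo :: "((nat \<Rightarrow> real) \<Rightarrow> nat) \<Rightarrow> nat \<Rightarrow> (nat \<Rightarrow> real) \<Rightarrow> real" where
  "L_zo am j \<gamma> = (if j \<noteq> am \<gamma> then 1 else 0)"

definition H_zo :: "nat \<Rightarrow> (nat \<Rightarrow> real) \<Rightarrow> real" where
  "H_zo m \<eta> = 1 - (MAX k\<in>{1..m}. \<eta> k)"

definition tau_dagger :: "nat \<Rightarrow> (nat \<Rightarrow> real) \<Rightarrow> nat \<Rightarrow> real" where
  "tau_dagger m \<tau> = (\<lambda>k\<in>{1..m}. if k < m then \<tau> k else 1 - (\<Sum>l=1..m-1. pos (\<tau> l)))"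

definition tau_tilde :: "nat \<Rightarrow> (nat \<Rightarrow> real) \<Rightarrow> nat \<Rightarrow> real" where
  "tau_tilde m \<tau> = (\<lambda>k\<in>{1..m}. if k < m then \<tau> k else 1 - (\<Sum>l=1..m-1. \<tau> l))"

definition L_cw3 :: "nat \<Rightarrow> (nat \<Rightarrow> nat \<Rightarrow> real) \<Rightarrow> nat \<Rightarrow> (nat \<Rightarrow> real) \<Rightarrow> real" where
  "L_cw3 m C j \<tau> =
     (if j < m
      then C j m * pos (1 - \<tau> j - (\<Sum>k\<in>{1..m-1}-{j}. pos (\<tau> k)))
           + (\<Sum>k\<in>{1..m-1}-{j}. C j k * pos (\<tau> k))
      else (\<Sum>k=1..m-1. C m k * pos (\<tau> k)))"

text \<open>
  The components of \<open>\<gamma>\<close> other than the \<open>j\<close>-th, in decreasing order (with multiplicity).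
\<close>

definition sorted_others :: "nat \<Rightarrow> (nat \<Rightarrow> real) \<Rightarrow> nat \<Rightarrow> real list" where
  "sorted_others m \<gamma> j = rev (sort (map \<gamma> (filter (\<lambda>k. k \<noteq> j) [1..<Suc m])))"

definition S_zo :: "nat \<Rightarrow> (nat \<Rightarrow> real) \<Rightarrow> nat \<Rightarrow> real" where
  "S_zo m \<gamma> j =
     Max (insert 0 ((\<lambda>r. (\<gamma> j + sum_list (take r (sorted_others m \<gamma> j)) - 1) / real (r + 1))
                    ` {0..m-2}))"

definition L_zo4 :: "nat \<Rightarrow> nat \<Rightarrow> (nat \<Rightarrow> real) \<Rightarrow> real" where
  "L_zo4 m j \<tau> = 1 - tau_tilde m \<tau> j + S_zo m (tau_tilde m \<tau>) j"

lemma tau_dagger_Rvec: "tau_dagger m \<tau> \<in> Rvec m"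
  by (simp add: tau_dagger_def Rvec_def)

lemma tau_tilde_Rvec: "tau_tilde m \<tau> \<in> Rvec m"
  by (simp add: tau_tilde_def Rvec_def)

lemma Rvec_nonempty: "Rvec n \<noteq> {}"
  by (simp add: Rvec_def PiE_eq_empty_iff)

lemma bdd_below_risk:
  assumes "\<eta> \<in> prob_simplex m" "\<And>j \<gamma>. j \<in> {1..m} \<Longrightarrow> \<gamma> \<in> A \<Longrightarrow> 0 \<le> L j \<gamma>"
  shows "bdd_below (risk m L \<eta> ` A)"
proof (rule bdd_belowI2)
  show "0 \<le> risk m L \<eta> \<gamma>" if "\<gamma> \<in> A" for \<gamma>
    using assms that by (auto simp: risk_def prob_simplex_def intro!: sum_nonneg)
qed

lemma L_cw3_nonneg:
  assumes "cost_matrix m C" "j \<in> {1..m}"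
  shows "0 \<le> L_cw3 m C j \<tau>"
proof -
  have "0 \<le> C i k" if "i \<in> {1..m}" "k \<in> {1..m}" for i k
    using assms(1) that by (auto simp: cost_matrix_def)
  moreover have "0 \<le> pos x" for x
    by simp
  ultimately show ?thesis
    using assms(2) unfolding L_cw3_def
    by (auto intro!: sum_nonneg add_nonneg_nonneg mult_nonneg_nonneg)
qed

lemma L_zo4_nonneg: "0 \<le> L_zo4 m j \<tau>"
proof -
  let ?t = "tau_tilde m \<tau>"
  have "?t j - 1 \<le> S_zo m ?t j"
    unfolding S_zo_def by (rule Max_ge) (auto intro!: image_eqI[where x = 0])
  then show ?thesis
    by (simp add: L_zo4_def)
qed

lemma argmax_rule_surj:
  assumes "argmax_rule m am" "k \<in> {1..m}"
  shows "\<exists>\<gamma>\<in>Rvec m. am \<gamma> = k"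
proof -
  define \<gamma> :: "nat \<Rightarrow> real" where "\<gamma> = (\<lambda>i\<in>{1..m}. if i = k then 1 else 0)"
  have "\<gamma> \<in> Rvec m"
    by (simp add: \<gamma>_def Rvec_def)
  then have "am \<gamma> \<in> {1..m}" "\<gamma> k \<le> \<gamma> (am \<gamma>)"
    using assms by (auto simp: argmax_rule_def)
  then have "am \<gamma> = k"
    using assms(2) by (auto simp: \<gamma>_def split: if_splits)
  with \<open>\<gamma> \<in> Rvec m\<close> show ?thesis
    by blast
qed

text \<open>
  The closed forms \<open>H_cw\<close> and \<open>H_zo\<close> are the entropies of the corresponding losses, whatever
  the tie-breaking rule.
\<close>

lemma entropy_L_cw:
  assumes "m \<ge> 2" "argmax_rule m am"
  shows "entropy m (Rvec m) (L_cw am C) \<eta> = H_cw m C \<eta>"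
proof -
  have img: "am ` Rvec m = {1..m}"
    using argmax_rule_surj[OF assms(2)] assms(2) by (fastforce simp: argmax_rule_def)
  have "risk m (L_cw am C) \<eta> ` Rvec m = (\<lambda>k. \<Sum>j=1..m. \<eta> j * C j k) ` (am ` Rvec m)"
    by (simp add: image_image risk_def L_cw_def)
  then show ?thesis
    using assms(1) unfolding entropy_def H_cw_def img by (simp add: cInf_eq_Min)
qed

lemma entropy_L_zo:
  assumes "m \<ge> 2" "argmax_rule m am" "\<eta> \<in> prob_simplex m"
  shows "entropy m (Rvec m) (L_zo am) \<eta> = H_zo m \<eta>"
proof -
  have img: "am ` Rvec m = {1..m}"
    using argmax_rule_surj[OF assms(2)] assms(2) by (fastforce simp: argmax_rule_def)
  have risk_eq: "risk m (L_zo am) \<eta> \<gamma> = 1 - \<eta> (am \<gamma>)" if "\<gamma> \<in> Rvec m" for \<gamma>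
  proof -
    have "am \<gamma> \<in> {1..m}"
      using assms(2) that by (auto simp: argmax_rule_def)
    then have "(\<Sum>j=1..m. \<eta> j) = \<eta> (am \<gamma>) + (\<Sum>j\<in>{1..m}-{am \<gamma>}. \<eta> j)"
      "risk m (L_zo am) \<eta> \<gamma> = (\<Sum>j\<in>{1..m}-{am \<gamma>}. \<eta> j)"
      by (auto simp: risk_def L_zo_def sum.remove intro!: sum.cong)
    then show ?thesis
      using assms(3) by (simp add: prob_simplex_def)
  qed
  have "risk m (L_zo am) \<eta> ` Rvec m = (\<lambda>k. 1 - \<eta> k) ` (am ` Rvec m)"
    by (force simp: risk_eq image_image)
  then have "entropy m (Rvec m) (L_zo am) \<eta> = Min ((\<lambda>k. 1 - \<eta> k) ` {1..m})"
    using assms(1) unfolding entropy_def img by (simp add: cInf_eq_Min)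
  also have "\<dots> = 1 - Max (\<eta> ` {1..m})"
  proof (rule Min_eqI)
    have "Max (\<eta> ` {1..m}) \<in> \<eta> ` {1..m}"
      using assms(1) by (intro Max_in) auto
    then show "1 - Max (\<eta> ` {1..m}) \<in> (\<lambda>k. 1 - \<eta> k) ` {1..m}"
      by auto
  qed auto
  finally show ?thesis
    by (simp add: H_zo_def)
qed

end

theory Submission
  imports Defs
begin

text \<open>
  Both hinge-like risks dominate \<open>\<Sum>\<^sub>k a\<^sub>k p\<^sub>k\<close>, where \<open>a\<^sub>k\<close> is the conditional classification risk
  of predicting class \<open>k\<close> and \<open>p\<close> is a nonnegative vector of total mass at least one, ordered as
  the scores: the positive part of \<open>\<tau>\<^sup>\<dagger>\<close> in (i) and the Euclidean projection of the scores onto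
  the simplex in (ii). Indicator vectors attain \<open>a\<^sub>k\<close>, so the surrogate entropy is at most
  \<open>min\<^sub>k a\<^sub>k\<close>, while the largest component of \<open>p\<close>, found at the predicted class, is at least \<open>1/m\<close>.
\<close>

section \<open>Averaging inequality and entropy bound shared by both parts\<close>

lemma mean_le_max_component:
  fixes p :: "nat \<Rightarrow> real"
  assumes "m \<ge> 1" "1 \<le> (\<Sum>k=1..m. p k)" "\<And>l. l \<in> {1..m} \<Longrightarrow> p l \<le> p \<kappa>"
  shows "1 / real m \<le> p \<kappa>"
proof -
  have "(\<Sum>k=1..m. p k) \<le> real (card {1..m}) * p \<kappa>"
    using assms(3) by (rule sum_bounded_above)
  with assms(1,2) show ?thesis
    by (simp add: field_simps)
qed

text \<open>All terms \<open>p k * (a k - M)\<close> are nonnegative, so their sum is at least the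
  term at \<open>\<kappa>\<close>, whose weight is at least \<open>1 / m\<close>. Mass above one,
  which occurs in the cost-weighted case, does no harm because \<open>M\<close> is
  nonnegative.\<close>

lemma regret_weighted_lower_bound:
  fixes a p :: "nat \<Rightarrow> real"
  assumes m: "m \<ge> 1" and \<kappa>: "\<kappa> \<in> {1..m}"
    and p: "\<And>k. k \<in> {1..m} \<Longrightarrow> 0 \<le> p k" "1 \<le> (\<Sum>k=1..m. p k)"
      "\<And>l. l \<in> {1..m} \<Longrightarrow> p l \<le> p \<kappa>"
    and M: "0 \<le> M" "\<And>k. k \<in> {1..m} \<Longrightarrow> M \<le> a k"
  shows "1 / real m * (a \<kappa> - M) \<le> (\<Sum>k=1..m. a k * p k) - M"
proof -
  have "1 / real m * (a \<kappa> - M) \<le> p \<kappa> * (a \<kappa> - M)"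
    using mean_le_max_component[OF m p(2,3)] M(2)[OF \<kappa>] by (intro mult_right_mono) auto
  also have "\<dots> \<le> (\<Sum>k=1..m. p k * (a k - M))"
    using \<kappa> p(1) M(2) by (intro member_le_sum) auto
  also have "\<dots> = (\<Sum>k=1..m. a k * p k) - M * (\<Sum>k=1..m. p k)"
    by (simp add: algebra_simps sum_subtractf sum_distrib_left)
  also have "\<dots> \<le> (\<Sum>k=1..m. a k * p k) - M"
    using mult_left_mono[OF p(2) M(1)] by simp
  finally show ?thesis .
qed

text \<open>Class \<open>m\<close> has no coordinate of its own: for \<open>k = m\<close> this is
  the zero vector, and the last component of \<open>tau_dagger\<close> or \<open>tau_tilde\<close>
  supplies the missing one.\<close>

definition indicator_action :: "nat \<Rightarrow> nat \<Rightarrow> nat \<Rightarrow> real" where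
  "indicator_action m k = (\<lambda>i\<in>{1..m-1}. if i = k then 1 else 0)"

lemma indicator_action_Rvec: "indicator_action m k \<in> Rvec (m - 1)"
  by (simp add: indicator_action_def Rvec_def)

text \<open>Nonnegativity of the loss bounds the risks below, which makes the real
  \<open>INF\<close> a genuine lower bound.\<close>

lemma entropy_le_risk:
  assumes "\<eta> \<in> prob_simplex m" "\<And>j \<gamma>. j \<in> {1..m} \<Longrightarrow> \<gamma> \<in> A \<Longrightarrow> 0 \<le> L j \<gamma>" "\<gamma> \<in> A"
  shows "entropy m A L \<eta> \<le> risk m L \<eta> \<gamma>"
  unfolding entropy_def using assms by (intro cINF_lower bdd_below_risk)

lemma sum_atLeast1_last:
  fixes f :: "nat \<Rightarrow> real"
  assumes "m \<ge> 1"
  shows "(\<Sum>k=1..m. f k) = (\<Sum>k=1..m-1. f k) + f m"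
  using assms by (cases m) auto


subsection \<open>Cost-weighted classification\<close>

text \<open>Since \<open>C j j = 0\<close>, the two sides differ only in the hinge weighted by
  \<open>C j m\<close>, where the loss has \<tau>_j in place of its positive part; a negative
  \<tau>_j can only enlarge that hinge. For \<open>j = m\<close> the last term vanishes and equality
  holds.\<close>

lemma L_cw3_ge_weighted_cost:
  assumes C: "cost_matrix m C" and m: "m \<ge> 2" and j: "j \<in> {1..m}"
  shows "(\<Sum>k=1..m. C j k * pos (tau_dagger m \<tau> k)) \<le> L_cw3 m C j \<tau>"
proof -
  have Cjj: "C j j = 0" and Cjm: "0 \<le> C j m"
    using C j m by (auto simp: cost_matrix_def)
  have split: "(\<Sum>k=1..m. C j k * pos (tau_dagger m \<tau> k)) =
      (\<Sum>k=1..m-1. C j k * pos (\<tau> k)) + C j m * pos (1 - (\<Sum>l=1..m-1. pos (\<tau> l)))"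
    using m by (subst sum_atLeast1_last) (auto simp: tau_dagger_def intro!: sum.cong)
  show ?thesis
  proof (cases "j < m")
    case True
    then have mem: "j \<in> {1..m-1}"
      using j by auto
    have "(\<Sum>l=1..m-1. pos (\<tau> l)) = pos (\<tau> j) + (\<Sum>k\<in>{1..m-1}-{j}. pos (\<tau> k))"
      "(\<Sum>k=1..m-1. C j k * pos (\<tau> k)) = (\<Sum>k\<in>{1..m-1}-{j}. C j k * pos (\<tau> k))"
      using mem Cjj by (simp_all add: sum.remove)
    moreover have "C j m * pos (1 - (pos (\<tau> j) + s)) \<le> C j m * pos (1 - \<tau> j - s)" for s
      using Cjm by (intro mult_left_mono) auto
    ultimately show ?thesis
      using True unfolding split L_cw3_def by auto
  next
    case False
    then show ?thesis
      using j Cjj unfolding split L_cw3_def by auto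
  qed
qed

lemma L_cw3_indicator_action:
  assumes C: "cost_matrix m C" and m: "m \<ge> 2" and j: "j \<in> {1..m}" and k: "k \<in> {1..m}"
  shows "L_cw3 m C j (indicator_action m k) = C j k"
proof -
  let ?e = "indicator_action m k"
  have Cjj: "C j j = 0"
    using C j by (auto simp: cost_matrix_def)
  have pos_e: "pos (?e i) = (if i = k then 1 else 0)" if "i \<in> {1..m-1}" for i
    using that by (auto simp: indicator_action_def)
  \<comment> \<open>Taking \<open>f\<close> constant or a row of \<open>C\<close> evaluates every
    sum in \<open>L_cw3\<close>; the value 0 covers both \<open>k = m\<close> and the excluded index
    \<open>k = j\<close>.\<close>
  have mass: "(\<Sum>i\<in>B. f i * pos (?e i)) = (if k \<in> B then f k else 0)"
    if "B \<subseteq> {1..m-1}" for B and f :: "nat \<Rightarrow> real"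
  proof -
    have "(\<Sum>i\<in>B. f i * pos (?e i)) = (\<Sum>i\<in>B. if k = i then f i else 0)"
      using that by (intro sum.cong) (auto simp: pos_e)
    then show ?thesis
      using finite_subset[OF that] by (simp add: sum.delta')
  qed
  have "k \<in> {1..m-1} \<or> k = m"
    using k by auto
  show ?thesis
  proof (cases "j < m")
    case True
    have "(\<Sum>i\<in>{1..m-1}-{j}. pos (?e i)) = (if k \<in> {1..m-1}-{j} then 1 else 0)"
      using mass[of "{1..m-1}-{j}" "\<lambda>_. 1"] by auto
    moreover have "?e j = (if j = k then 1 else 0)"
      using True j by (auto simp: indicator_action_def)
    ultimately show ?thesis
      using True j k Cjj mass[of "{1..m-1}-{j}" "C j"] \<open>k \<in> {1..m-1} \<or> k = m\<close>
      by (auto simp: L_cw3_def)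
  next
    case False
    then show ?thesis
      using j k Cjj mass[of "{1..m-1}" "C m"] \<open>k \<in> {1..m-1} \<or> k = m\<close> by (auto simp: L_cw3_def)
  qed
qed

lemma cw3_regret_bound:
  assumes m: "m \<ge> 2" and am: "argmax_rule m am" and C: "cost_matrix m C"
    and \<eta>: "\<eta> \<in> prob_simplex m"
  shows "1 / real m * (risk m (L_cw am C) \<eta> (tau_dagger m \<tau>) - H_cw m C \<eta>)
    \<le> risk m (L_cw3 m C) \<eta> \<tau> - entropy m (Rvec (m - 1)) (L_cw3 m C) \<eta>"
proof -
  let ?t = "tau_dagger m \<tau>"
  define a where "a k = (\<Sum>j=1..m. \<eta> j * C j k)" for k
  have \<eta>_nonneg: "0 \<le> \<eta> j" if "j \<in> {1..m}" for j
    using \<eta> that by (auto simp: prob_simplex_def)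
  have H: "H_cw m C \<eta> = Min (a ` {1..m})"
    by (simp add: H_cw_def a_def)
  have "H_cw m C \<eta> \<in> a ` {1..m}"
    unfolding H using m by (intro Min_in) auto
  then obtain k where k: "k \<in> {1..m}" "H_cw m C \<eta> = a k"
    by auto
  have a_nonneg: "0 \<le> a i" if "i \<in> {1..m}" for i
    using C \<eta>_nonneg that unfolding a_def by (intro sum_nonneg) (auto simp: cost_matrix_def)
  have am_t: "am ?t \<in> {1..m}" "\<And>l. l \<in> {1..m} \<Longrightarrow> ?t l \<le> ?t (am ?t)"
    using am tau_dagger_Rvec[of m \<tau>] by (auto simp: argmax_rule_def)
  have "(\<Sum>i=1..m. pos (?t i)) = (\<Sum>i=1..m-1. pos (\<tau> i)) + pos (1 - (\<Sum>i=1..m-1. pos (\<tau> i)))"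
    using m by (subst sum_atLeast1_last) (auto simp: tau_dagger_def intro!: sum.cong)
  then have mass: "1 \<le> (\<Sum>i=1..m. pos (?t i))"
    by simp
  have "1 / real m * (a (am ?t) - H_cw m C \<eta>) \<le> (\<Sum>i=1..m. a i * pos (?t i)) - H_cw m C \<eta>"
  proof (rule regret_weighted_lower_bound)
    show "pos (?t l) \<le> pos (?t (am ?t))" if "l \<in> {1..m}" for l
      using am_t(2)[OF that] by auto
    show "H_cw m C \<eta> \<le> a i" if "i \<in> {1..m}" for i
      unfolding H using that by auto
  qed (use m am_t mass k a_nonneg in auto)
  \<comment> \<open>Exchanging the sums turns the bound on class risks into one per true class
    \<open>j\<close>, to which the pointwise estimate applies.\<close>
  also have "(\<Sum>i=1..m. a i * pos (?t i)) = (\<Sum>j=1..m. \<eta> j * (\<Sum>i=1..m. C j i * pos (?t i)))"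
    unfolding a_def sum_distrib_right sum_distrib_left by (subst sum.swap) (simp add: mult.assoc)
  also have "\<dots> \<le> risk m (L_cw3 m C) \<eta> \<tau>"
    unfolding risk_def
    by (intro sum_mono mult_left_mono L_cw3_ge_weighted_cost[OF C m] \<eta>_nonneg)
  finally have "1 / real m * (a (am ?t) - H_cw m C \<eta>) \<le> risk m (L_cw3 m C) \<eta> \<tau> - H_cw m C \<eta>"
    by simp
  moreover have "entropy m (Rvec (m - 1)) (L_cw3 m C) \<eta> \<le> H_cw m C \<eta>"
  proof -
    have "entropy m (Rvec (m - 1)) (L_cw3 m C) \<eta> \<le> risk m (L_cw3 m C) \<eta> (indicator_action m k)"
      using \<eta> L_cw3_nonneg[OF C] indicator_action_Rvec by (rule entropy_le_risk)
    also have "\<dots> = a k"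
      using L_cw3_indicator_action[OF C m _ k(1)] by (simp add: risk_def a_def)
    finally show ?thesis
      using k(2) by simp
  qed
  ultimately show ?thesis
    by (simp add: risk_def L_cw_def a_def)
qed


subsection \<open>Zero-one classification\<close>

lemma sum_tau_tilde:
  assumes "m \<ge> 1"
  shows "(\<Sum>k=1..m. tau_tilde m \<tau> k) = 1"
proof -
  have "(\<Sum>k=1..m-1. tau_tilde m \<tau> k) = (\<Sum>k=1..m-1. \<tau> k)"
    by (intro sum.cong) (auto simp: tau_tilde_def)
  with assms show ?thesis
    by (subst sum_atLeast1_last) (auto simp: tau_tilde_def)
qed

text \<open>The truncated mass is continuous in \<theta>, at least 1 at \<theta> = 0 and 0 beyond
  the largest score, so it takes the value 1 in between.\<close>

lemma simplex_projection_threshold: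
  fixes t :: "nat \<Rightarrow> real"
  assumes m: "m \<ge> 1" and sum_t: "(\<Sum>k=1..m. t k) = 1"
  obtains \<theta> where "(\<Sum>k=1..m. pos (t k - \<theta>)) = 1"
proof -
  define f where "f \<theta> = (\<Sum>k=1..m. pos (t k - \<theta>))" for \<theta>
  \<comment> \<open>The positive part makes \<open>{0..b}\<close> a valid interval for the
    intermediate value theorem.\<close>
  define b where "b = pos (Max (t ` {1..m}))"
  have "t k \<le> b" if "k \<in> {1..m}" for k
  proof -
    have "t k \<le> Max (t ` {1..m})"
      using that by simp
    then show ?thesis
      by (simp add: b_def)
  qed
  then have "f b = 0"
    unfolding f_def by (intro sum.neutral) auto
  moreover have "1 \<le> f 0"
    unfolding f_def sum_t[symmetric] by (intro sum_mono) simp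
  moreover have "continuous_on {0..b} f"
    unfolding f_def by (intro continuous_intros)
  moreover have "0 \<le> b"
    by (simp add: b_def)
  ultimately obtain \<theta> where "f \<theta> = 1"
    using IVT2'[of f b 1 0] by auto
  then show ?thesis
    using that by (simp add: f_def)
qed

text \<open>This turns sums and lengths over the sorted list into sums and cardinalities over index
  sets, with ties counted correctly.\<close>

lemma mset_sorted_others:
  "mset (sorted_others m t j) = image_mset t (mset_set ({1..m} - {j}))"
proof -
  define xs where "xs = filter (\<lambda>k. k \<noteq> j) [1..<Suc m]"
  have "mset (sorted_others m t j) = image_mset t (mset xs)"
    unfolding sorted_others_def xs_def by (simp only: mset_rev mset_sort mset_map)
  also have "mset xs = mset_set (set xs)"
    by (rule mset_set_set[symmetric]) (simp add: xs_def)
  also have "set xs = {1..m} - {j}"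
    by (auto simp: xs_def)
  finally show ?thesis .
qed

text \<open>
  The case \<open>A = {1..m}\<close> is missing from \<^const>\<open>S_zo\<close>, but there the quotient is \<open>0\<close>.
\<close>

lemma S_zo_ge_superlevel:
  fixes t :: "nat \<Rightarrow> real"
  assumes m: "m \<ge> 1" and sum_t: "(\<Sum>k=1..m. t k) = 1" and j: "j \<in> {1..m}"
    and A: "A = insert j {k \<in> {1..m}. \<theta> < t k}"
  shows "((\<Sum>k\<in>A. t k) - 1) / real (card A) \<le> S_zo m t j"
proof (cases "A = {1..m}")
  case True
  have "0 \<le> S_zo m t j"
    unfolding S_zo_def by (rule Max_ge) auto
  with True sum_t show ?thesis
    by simp
next
  case False
  let ?L = "sorted_others m t j" and ?P = "\<lambda>x. \<theta> < x"
  define B where "B = {k \<in> {1..m}. \<theta> < t k} - {j}"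
  have A_B: "A = insert j B" "j \<notin> B" "finite B"
    by (auto simp: A B_def)
  define r where "r = length (filter ?P ?L)"
  have "sorted (rev ?L)"
    by (simp add: sorted_others_def)
  \<comment> \<open>In a decreasing list the entries above \<theta> form a prefix, here of length
    \<open>r\<close>.\<close>
  then have take_r: "take r ?L = filter ?P ?L"
    unfolding r_def
    by (subst (1 2) filter_equals_takeWhile_sorted_rev[where f = id, simplified])
      (auto simp: takeWhile_eq_take[symmetric])
  have "{k \<in> {1..m} - {j}. \<theta> < t k} = B"
    by (auto simp: B_def)
  then have mset_L: "mset (filter ?P ?L) = image_mset t (mset_set B)"
    by (simp add: mset_sorted_others filter_mset_image_mset filter_mset_mset_set)
  have "r = card B"
    using arg_cong[OF mset_L, of size] by (simp add: r_def flip: size_mset)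
  moreover have "sum_list (take r ?L) = sum t B"
    unfolding take_r sum_unfold_sum_mset mset_L[symmetric] by (rule sum_mset_sum_list[symmetric])
  ultimately have "((\<Sum>k\<in>A. t k) - 1) / real (card A) =
      (t j + sum_list (take r ?L) - 1) / real (r + 1)"
    using A_B by simp
  \<comment> \<open>\<open>A\<close> is a proper subset with \<open>r + 1\<close> elements, so
    \<open>r\<close> stays within the range of the maximum in \<open>S_zo\<close>.\<close>
  moreover have "r \<in> {0..m-2}"
  proof -
    have "A \<subset> {1..m}"
      using False j by (auto simp: A)
    then have "card A < m"
      using psubset_card_mono[of "{1..m}" A] by simp
    then show ?thesis
      using A_B \<open>r = card B\<close> by simp
  qed
  ultimately show ?thesis
    unfolding S_zo_def by (intro Max_ge) auto
qed

text \<open>Let \<open>K\<close> be the set of scores above \<theta>. Mass one means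
  \<open>sum t K - 1 = card K * \<theta>\<close>. If \<open>j\<close> lies in \<open>K\<close>, the
  quotient for \<open>K\<close> is exactly \<theta>, so \<open>S_zo\<close> is at least \<theta>.
  Otherwise the quotient for \<open>insert j K\<close> averages \<open>card K\<close> copies of
  \<theta> with \<open>t j \<le> \<theta>\<close>, so \<open>S_zo\<close> is at least
  \<open>t j\<close> and the left side is nonpositive.\<close>

lemma score_minus_S_zo_le_projection:
  fixes t :: "nat \<Rightarrow> real"
  assumes m: "m \<ge> 1" and sum_t: "(\<Sum>k=1..m. t k) = 1" and j: "j \<in> {1..m}"
    and \<theta>: "(\<Sum>k=1..m. pos (t k - \<theta>)) = 1"
  shows "t j - S_zo m t j \<le> pos (t j - \<theta>)"
proof -
  define K where "K = {k \<in> {1..m}. \<theta> < t k}"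
  have K: "finite K"
    by (simp add: K_def)
  have "(\<Sum>k=1..m. pos (t k - \<theta>)) = (\<Sum>k\<in>K. t k - \<theta>)"
    by (rule sum.mono_neutral_cong_right) (auto simp: K_def)
  then have sum_K: "sum t K = 1 + real (card K) * \<theta>"
    using \<theta> by (simp add: sum_subtractf)
  have S: "((\<Sum>k\<in>insert j K. t k) - 1) / real (card (insert j K)) \<le> S_zo m t j"
    using m sum_t j by (rule S_zo_ge_superlevel) (simp add: K_def)
  show ?thesis
  proof (cases "j \<in> K")
    case True
    then have "card K > 0"
      using K by (auto simp: card_gt_0_iff)
    then have "\<theta> \<le> S_zo m t j"
      using S True by (simp add: insert_absorb sum_K)
    then show ?thesis
      by auto
  next
    case False
    then have "t j \<le> \<theta>"
      using j by (auto simp: K_def)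
    then have "real (card K) * t j \<le> real (card K) * \<theta>"
      by (intro mult_left_mono) auto
    then have "t j \<le> (real (card K) * \<theta> + t j) / real (Suc (card K))"
      by (simp add: field_simps)
    also have "\<dots> \<le> S_zo m t j"
      using S K False by (simp add: sum_K algebra_simps)
    finally show ?thesis
      by auto
  qed
qed

lemma tau_tilde_indicator_action:
  assumes "m \<ge> 2" "k \<in> {1..m}" "i \<in> {1..m}"
  shows "tau_tilde m (indicator_action m k) i = (if i = k then 1 else 0)"
proof -
  have "(\<Sum>l=1..m-1. indicator_action m k l) = (\<Sum>l=1..m-1. if k = l then 1 else 0)"
    by (intro sum.cong) (auto simp: indicator_action_def)
  also have "\<dots> = (if k \<in> {1..m-1} then 1 else 0)"
    by simp
  finally show ?thesis
    using assms by (auto simp: tau_tilde_def indicator_action_def)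
qed

text \<open>The completed scores are nonnegative with total one, so no partial sum exceeds one and
  every quotient in \<open>S_zo\<close> is at most 0. An upper bound suffices for estimating the
  entropy from above.\<close>

lemma L_zo4_indicator_action_le:
  assumes m: "m \<ge> 2" and j: "j \<in> {1..m}" and k: "k \<in> {1..m}"
  shows "L_zo4 m j (indicator_action m k) \<le> (if j = k then 0 else 1)"
proof -
  define t where "t = tau_tilde m (indicator_action m k)"
  have t: "t i = (if i = k then 1 else 0)" if "i \<in> {1..m}" for i
    unfolding t_def using m k that by (rule tau_tilde_indicator_action)
  let ?L = "sorted_others m t j"
  have nonneg: "0 \<le> x" if "x \<in> set ?L" for x
    using that t by (auto simp: sorted_others_def split: if_splits)
  have "sum_list ?L = (\<Sum>i\<in>{1..m}-{j}. t i)"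
    unfolding sum_unfold_sum_mset mset_sorted_others[symmetric]
    by (rule sum_mset_sum_list[symmetric])
  then have "t j + sum_list ?L = (\<Sum>i=1..m. t i)"
    using j by (simp add: sum.remove)
  also have "\<dots> = 1"
    unfolding t_def using m by (intro sum_tau_tilde) simp
  finally have total: "t j + sum_list ?L = 1" .
  have "t j + sum_list (take r ?L) - 1 \<le> 0" for r
  proof -
    have "0 \<le> sum_list (drop r ?L)"
      using nonneg by (intro sum_list_nonneg) (auto dest: in_set_dropD)
    moreover have "sum_list ?L = sum_list (take r ?L) + sum_list (drop r ?L)"
      by (metis append_take_drop_id sum_list.append)
    ultimately show ?thesis
      using total by simp
  qed
  then have "S_zo m t j \<le> 0"
    unfolding S_zo_def by (intro Max.boundedI) (auto simp: divide_nonpos_pos)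
  then show ?thesis
    using t[OF j] by (auto simp: L_zo4_def t_def)
qed

lemma zo4_regret_bound:
  assumes m: "m \<ge> 2" and am: "argmax_rule m am" and \<eta>: "\<eta> \<in> prob_simplex m"
  shows "1 / real m * (risk m (L_zo am) \<eta> (tau_tilde m \<tau>) - H_zo m \<eta>)
    \<le> risk m (L_zo4 m) \<eta> \<tau> - entropy m (Rvec (m - 1)) (L_zo4 m) \<eta>"
proof -
  let ?t = "tau_tilde m \<tau>"
  have \<eta>_nonneg: "0 \<le> \<eta> j" if "j \<in> {1..m}" for j
    using \<eta> that by (auto simp: prob_simplex_def)
  have \<eta>_sum: "(\<Sum>j=1..m. \<eta> j) = 1"
    using \<eta> by (simp add: prob_simplex_def)
  have \<eta>_le1: "\<eta> j \<le> 1" if "j \<in> {1..m}" for j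
    using member_le_sum[of j "{1..m}" \<eta>] \<eta>_nonneg \<eta>_sum that by auto
  \<comment> \<open>Serves twice: for the predicted class and for the class attaining
    \<open>H_zo\<close>.\<close>
  have risk_indicator: "(\<Sum>j=1..m. \<eta> j * (if j = k then 0 else 1)) = 1 - \<eta> k"
    if "k \<in> {1..m}" for k
  proof -
    have "(\<Sum>j=1..m. \<eta> j * (if j = k then 0 else 1)) = (\<Sum>j\<in>{1..m}-{k}. \<eta> j)"
      by (rule sum.mono_neutral_cong_right) auto
    then show ?thesis
      using \<eta>_sum that by (simp add: sum.remove)
  qed
  have "Max (\<eta> ` {1..m}) \<in> \<eta> ` {1..m}"
    using m by (intro Max_in) auto
  then obtain k where k: "k \<in> {1..m}" "H_zo m \<eta> = 1 - \<eta> k"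
    unfolding H_zo_def by (metis imageE)
  have am_t: "am ?t \<in> {1..m}" "\<And>l. l \<in> {1..m} \<Longrightarrow> ?t l \<le> ?t (am ?t)"
    using am tau_tilde_Rvec[of m \<tau>] by (auto simp: argmax_rule_def)
  have sum_t: "(\<Sum>i=1..m. ?t i) = 1"
    using m by (intro sum_tau_tilde) simp
  have m1: "m \<ge> 1"
    using m by simp
  obtain \<theta> where \<theta>: "(\<Sum>i=1..m. pos (?t i - \<theta>)) = 1"
    using simplex_projection_threshold[OF m1 sum_t] by blast
  let ?p = "\<lambda>i. pos (?t i - \<theta>)"
  have "1 / real m * ((1 - \<eta> (am ?t)) - H_zo m \<eta>) \<le> (\<Sum>i=1..m. (1 - \<eta> i) * ?p i) - H_zo m \<eta>"
  proof (rule regret_weighted_lower_bound)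
    show "?p l \<le> ?p (am ?t)" if "l \<in> {1..m}" for l
      using am_t(2)[OF that] by auto
    show "0 \<le> H_zo m \<eta>"
      using k \<eta>_le1 by simp
    show "H_zo m \<eta> \<le> 1 - \<eta> i" if "i \<in> {1..m}" for i
      unfolding H_zo_def using that by auto
  qed (use m am_t \<theta> in auto)
  \<comment> \<open>Both \<eta> and the projection have total mass one, so each side equals one
    minus their inner product.\<close>
  also have "(\<Sum>i=1..m. (1 - \<eta> i) * ?p i) = (\<Sum>j=1..m. \<eta> j * (1 - ?p j))"
    using \<eta>_sum \<theta> by (simp add: algebra_simps sum_subtractf)
  also have "\<dots> \<le> risk m (L_zo4 m) \<eta> \<tau>"
    unfolding risk_def
  proof (intro sum_mono mult_left_mono \<eta>_nonneg)
    show "1 - ?p j \<le> L_zo4 m j \<tau>" if "j \<in> {1..m}" for j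
      using score_minus_S_zo_le_projection[OF m1 sum_t that \<theta>] by (simp add: L_zo4_def)
  qed
  finally have "1 / real m * ((1 - \<eta> (am ?t)) - H_zo m \<eta>) \<le> risk m (L_zo4 m) \<eta> \<tau> - H_zo m \<eta>"
    by simp
  moreover have "entropy m (Rvec (m - 1)) (L_zo4 m) \<eta> \<le> H_zo m \<eta>"
  proof -
    have "entropy m (Rvec (m - 1)) (L_zo4 m) \<eta> \<le> risk m (L_zo4 m) \<eta> (indicator_action m k)"
      using \<eta> L_zo4_nonneg indicator_action_Rvec by (rule entropy_le_risk)
    also have "\<dots> \<le> (\<Sum>j=1..m. \<eta> j * (if j = k then 0 else 1))"
      unfolding risk_def
      by (intro sum_mono mult_left_mono L_zo4_indicator_action_le[OF m _ k(1)] \<eta>_nonneg)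
    also have "\<dots> = H_zo m \<eta>"
      using risk_indicator k by simp
    finally show ?thesis .
  qed
  moreover have "risk m (L_zo am) \<eta> ?t = 1 - \<eta> (am ?t)"
    unfolding risk_def L_zo_def risk_indicator[OF am_t(1), symmetric]
    by (intro sum.cong) auto
  ultimately show ?thesis
    by simp
qed

theorem proposition7:
  fixes m :: nat and am :: "(nat \<Rightarrow> real) \<Rightarrow> nat"
  assumes "m \<ge> 2" and "argmax_rule m am"
  shows "(\<forall>C. cost_matrix m C \<longrightarrow>
            (\<forall>\<eta>\<in>prob_simplex m. \<forall>\<tau>\<in>Rvec (m - 1).
               1 / real m * (risk m (L_cw am C) \<eta> (tau_dagger m \<tau>) - H_cw m C \<eta>)
                 \<le> risk m (L_cw3 m C) \<eta> \<tau> - entropy m (Rvec (m - 1)) (L_cw3 m C) \<eta>))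
       \<and> (\<forall>\<eta>\<in>prob_simplex m. \<forall>\<tau>\<in>Rvec (m - 1).
               1 / real m * (risk m (L_zo am) \<eta> (tau_tilde m \<tau>) - H_zo m \<eta>)
                 \<le> risk m (L_zo4 m) \<eta> \<tau> - entropy m (Rvec (m - 1)) (L_zo4 m) \<eta>)"
  using cw3_regret_bound[OF assms] zo4_regret_bound[OF assms] by blast

end
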